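(* For $n\ge 2$, there are no $\Pi^0_n$-complete equivalence relations. That is, for every $n\geq 2$ and every $\Pi^0_n$ equivalence relation $E$ on $\mathbb{N}$ there is a $\Pi^0_n$ equivalence relation $F$ on $\mathbb{N}$ with $F\nleq E$.
   Context: For binary relations $A,B$ on $\mathbb{N}$, $A\le B$ (computable component-wise reducibility) means there is a computable function $f:\mathbb{N}\to\mathbb{N}$ with $(x,y)\in A\iff (f(x),f(y))\in B$ for all $x,y\in\mathbb{N}$. A $\Pi^0_n$ equivalence relation is an equivalence relation on $\mathbb{N}$ that is $\Pi^0_n$ in the arithmetical hierarchy as a set of pairs. An equivalence relation $E$ is $\Pi^0_n$-complete if it is $\Pi^0_n$ and $F\le E$ for every $\Pi^0_n$ equivalence relation $F$. *)

theory Defs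
  imports Main
begin

text \<open>Computability is not in the imported libraries, so it is introduced here through Kleene's
  partial recursive functions. An expression carries no arity: it is evaluated on argument lists of
  any length, and for each \<open>k\<close> its restriction to lists of length \<open>k\<close> is a \<open>k\<close>-ary partial recursive
  function (nowhere defined if \<open>k\<close> does not fit the expression).\<close>

datatype recf =
    Zero
  | Succ
  | Proj nat
  | Comp recf "recf list"
  | PrimRec recf recf
  | Mu recf

text \<open>\<open>evaluates f xs y\<close> means that \<open>f\<close> converges on the arguments \<open>xs\<close> with value \<open>y\<close>.\<close>

inductive evaluates :: "recf \<Rightarrow> nat list \<Rightarrow> nat \<Rightarrow> bool" where
  Zero: "evaluates Zero xs 0"
| Succ: "evaluates Succ [x] (Suc x)"
| Proj: "i < length xs \<Longrightarrow> evaluates (Proj i) xs (xs ! i)"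
| Comp: "list_all2 (\<lambda>g y. evaluates g xs y) gs ys \<Longrightarrow> evaluates f ys z
    \<Longrightarrow> evaluates (Comp f gs) xs z"
| PrimRec_0: "evaluates f xs y \<Longrightarrow> evaluates (PrimRec f g) (0 # xs) y"
| PrimRec_Suc: "evaluates (PrimRec f g) (m # xs) y \<Longrightarrow> evaluates g (m # y # xs) z
    \<Longrightarrow> evaluates (PrimRec f g) (Suc m # xs) z"
| Mu: "evaluates f (m # xs) 0 \<Longrightarrow> (\<forall>i<m. \<exists>y. evaluates f (i # xs) (Suc y))
    \<Longrightarrow> evaluates (Mu f) xs m"

definition computable :: "(nat \<Rightarrow> nat) \<Rightarrow> bool" where
  "computable f \<longleftrightarrow> (\<exists>r. \<forall>x. evaluates r [x] (f x))"

text \<open>A \<open>k\<close>-ary relation on the natural numbers is a predicate on lists, of which only the values on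
  lists of length \<open>k\<close> matter.\<close>

definition computable_rel :: "nat \<Rightarrow> (nat list \<Rightarrow> bool) \<Rightarrow> bool" where
  "computable_rel k R \<longleftrightarrow>
     (\<exists>r. \<forall>xs. length xs = k \<longrightarrow> evaluates r xs (if R xs then 1 else 0))"

text \<open>\<open>is_Sigma n k R\<close> and \<open>is_Pi n k R\<close>: the \<open>k\<close>-ary relation \<open>R\<close> is defined by \<open>n\<close> alternating
  number quantifiers, the outermost existential respectively universal, in front of a computable
  relation. Quantified variables are prepended to the argument list.\<close>

fun is_Sigma :: "nat \<Rightarrow> nat \<Rightarrow> (nat list \<Rightarrow> bool) \<Rightarrow> bool"
  and is_Pi :: "nat \<Rightarrow> nat \<Rightarrow> (nat list \<Rightarrow> bool) \<Rightarrow> bool" where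
  "is_Sigma 0 k R \<longleftrightarrow> computable_rel k R"
| "is_Sigma (Suc n) k R \<longleftrightarrow>
     (\<exists>Q. is_Pi n (Suc k) Q \<and> (\<forall>xs. length xs = k \<longrightarrow> (R xs \<longleftrightarrow> (\<exists>z. Q (z # xs)))))"
| "is_Pi 0 k R \<longleftrightarrow> computable_rel k R"
| "is_Pi (Suc n) k R \<longleftrightarrow>
     (\<exists>Q. is_Sigma n (Suc k) Q \<and> (\<forall>xs. length xs = k \<longrightarrow> (R xs \<longleftrightarrow> (\<forall>z. Q (z # xs)))))"

definition Pi_equiv :: "nat \<Rightarrow> (nat \<times> nat) set \<Rightarrow> bool" where
  "Pi_equiv n E \<longleftrightarrow> equiv UNIV E \<and> is_Pi n 2 (\<lambda>xs. (xs ! 0, xs ! 1) \<in> E)"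

definition reducible :: "(nat \<times> nat) set \<Rightarrow> (nat \<times> nat) set \<Rightarrow> bool" where
  "reducible A B \<longleftrightarrow> (\<exists>f. computable f \<and> (\<forall>x y. (x, y) \<in> A \<longleftrightarrow> (f x, f y) \<in> B))"

definition Pi_complete :: "nat \<Rightarrow> (nat \<times> nat) set \<Rightarrow> bool" where
  "Pi_complete n E \<longleftrightarrow> Pi_equiv n E \<and> (\<forall>F. Pi_equiv n F \<longrightarrow> reducible F E)"

end

theory Submission
  imports Defs "HOL-Library.Nat_Bijection"
begin

text \<open>Let \<open>E\<close> be \<open>\<Pi>\<^sub>n\<close> and let \<open>f\<^sub>e\<close> be the \<open>e\<close>-th partial computable function. In the column
  \<open>a = \<langle>e, 0\<rangle>\<close>, \<open>b = \<langle>e, 1\<rangle>\<close>, \<open>c\<^sub>i = \<langle>e, i + 2\<rangle>\<close> the relation \<open>F\<close> has the two classes of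
  \<open>a\<close> and \<open>b\<close>. If \<open>f\<^sub>e\<close> reduces \<open>F\<close> to \<open>E\<close>, then \<open>f\<^sub>e a\<close> and \<open>f\<^sub>e b\<close> are inequivalent, and this
  has a \<open>\<Pi>\<^sub>n\<^sub>-\<^sub>1\<close> witness \<open>i\<close>. Once it is known, transitivity of \<open>E\<close> makes \<open>f\<^sub>e c\<^sub>i\<close> inequivalent
  to \<open>f\<^sub>e a\<close> or to \<open>f\<^sub>e b\<close>, and \<open>F\<close> puts \<open>c\<^sub>i\<close> into the class of one from which it is separated
  in this way. Making that choice is an instance of the reduction property of \<open>\<Sigma>\<^sub>n\<close>, so \<open>F\<close> is even
  \<open>\<Delta>\<^sub>n\<close>. Nothing needs to be achieved for a non-total \<open>f\<^sub>e\<close>, but divergence has to be recognised,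
  and it is a \<open>\<Sigma>\<^sub>n\<close> event only because \<open>n \<ge> 2\<close>.\<close>

section \<open>Computable functions\<close>

definition computable_on :: "nat \<Rightarrow> (nat list \<Rightarrow> nat) \<Rightarrow> bool" where
  "computable_on k F \<longleftrightarrow> (\<exists>r. \<forall>xs. length xs = k \<longrightarrow> evaluates r xs (F xs))"

lemma computable_on_cong:
  assumes "computable_on k F" and "\<And>xs. length xs = k \<Longrightarrow> F xs = G xs"
  shows "computable_on k G"
  using assms unfolding computable_on_def by metis

lemma computable_iff_computable_on: "computable f \<longleftrightarrow> computable_on 1 (\<lambda>xs. f (xs ! 0))"
proof -
  have "(\<forall>x. evaluates r [x] (f x)) \<longleftrightarrow> (\<forall>xs. length xs = 1 \<longrightarrow> evaluates r xs (f (xs ! 0)))" for r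
    by (auto simp: length_Suc_conv)
  then show ?thesis
    unfolding computable_def computable_on_def by simp
qed

lemma computable_on_nth: "i < k \<Longrightarrow> computable_on k (\<lambda>xs. xs ! i)"
  unfolding computable_on_def by (metis evaluates.Proj)

lemma computable_on_comp:
  assumes "computable_on k F" and "\<And>i. i < k \<Longrightarrow> computable_on j (G i)"
  shows "computable_on j (\<lambda>xs. F (map (\<lambda>i. G i xs) [0..<k]))"
proof -
  obtain r where r: "\<And>xs. length xs = k \<Longrightarrow> evaluates r xs (F xs)"
    using assms(1) unfolding computable_on_def by blast
  obtain s where s: "\<And>i xs. i < k \<Longrightarrow> length xs = j \<Longrightarrow> evaluates (s i) xs (G i xs)"
    using assms(2) unfolding computable_on_def by metis
  have "evaluates (Comp r (map s [0..<k])) xs (F (map (\<lambda>i. G i xs) [0..<k]))"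
    if "length xs = j" for xs
    by (rule evaluates.Comp[OF _ r]) (auto simp: list_all2_conv_all_nth s that)
  then show ?thesis
    unfolding computable_on_def by blast
qed

lemma computable_on_comp1:
  assumes "computable f" and "computable_on k g"
  shows "computable_on k (\<lambda>xs. f (g xs))"
  using computable_on_comp[of 1 "\<lambda>xs. f (xs ! 0)" k "\<lambda>_. g"] assms
  by (simp add: computable_iff_computable_on)

lemma computable_on_comp2:
  assumes "computable_on 2 (\<lambda>xs. F (xs ! 0) (xs ! 1))"
    and "computable_on k g" and "computable_on k h"
  shows "computable_on k (\<lambda>xs. F (g xs) (h xs))"
  using computable_on_comp[of 2 "\<lambda>xs. F (xs ! 0) (xs ! 1)" k "\<lambda>i. if i = 0 then g else h"] assms
  by (simp add: numeral_2_eq_2)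

lemma computable_on_Suc: "computable_on k f \<Longrightarrow> computable_on k (\<lambda>xs. Suc (f xs))"
  by (rule computable_on_comp1[of Suc]) (auto simp: computable_def intro: evaluates.Succ)

lemma computable_on_const: "computable_on k (\<lambda>_. c)"
proof (induction c)
  case 0
  show ?case
    unfolding computable_on_def by (metis evaluates.Zero)
next
  case (Suc c)
  then show ?case
    by (rule computable_on_Suc)
qed

text \<open>\<open>F\<close> is given with its recursion equations instead of being constructed, so
  an existing function such as \<open>(+)\<close> or \<open>triangle\<close> is recognised as
  primitive recursive by checking two equations.\<close>

lemma computable_on_prim_rec:
  assumes "computable_on k f" and "computable_on (Suc (Suc k)) g"
    and "\<And>xs. F 0 xs = f xs" and "\<And>m xs. F (Suc m) xs = g (m # F m xs # xs)"
  shows "computable_on (Suc k) (\<lambda>xs. F (hd xs) (tl xs))"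
proof -
  obtain r where r: "\<And>xs. length xs = k \<Longrightarrow> evaluates r xs (f xs)"
    using assms(1) unfolding computable_on_def by blast
  obtain s where s: "\<And>xs. length xs = Suc (Suc k) \<Longrightarrow> evaluates s xs (g xs)"
    using assms(2) unfolding computable_on_def by blast
  have *: "evaluates (PrimRec r s) (m # xs) (F m xs)" if "length xs = k" for m xs
  proof (induction m)
    case 0
    show ?case
      using r[OF that] by (simp add: assms(3) evaluates.PrimRec_0)
  next
    case (Suc m)
    show ?case
      using s[of "m # F m xs # xs"] that by (simp add: assms(4) evaluates.PrimRec_Suc[OF Suc])
  qed
  have "evaluates (PrimRec r s) xs (F (hd xs) (tl xs))" if "length xs = Suc k" for xs
    using that * by (cases xs) auto
  then show ?thesis
    unfolding computable_on_def by blast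
qed

lemma computable_on_prim_rec2:
  assumes "computable_on 1 (\<lambda>xs. f (xs ! 0))"
    and "computable_on 3 (\<lambda>xs. g (xs ! 0) (xs ! 1) (xs ! 2))"
    and "\<And>x. F 0 x = f x" and "\<And>m x. F (Suc m) x = g m (F m x) x"
  shows "computable_on 2 (\<lambda>xs. F (xs ! 0) (xs ! 1))"
proof -
  have "computable_on (Suc 1) (\<lambda>xs. F (hd xs) (tl xs ! 0))"
    by (rule computable_on_prim_rec[where f = "\<lambda>xs. f (xs ! 0)"
          and g = "\<lambda>xs. g (xs ! 0) (xs ! 1) (xs ! 2)" and F = "\<lambda>m xs. F m (xs ! 0)"])
      (use assms in \<open>auto simp: numeral_eq_Suc\<close>)
  then show ?thesis
    unfolding numeral_2_eq_2 One_nat_def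
    by (rule computable_on_cong) (auto simp: length_Suc_conv)
qed

lemma computable_on_add:
  "computable_on k f \<Longrightarrow> computable_on k g \<Longrightarrow> computable_on k (\<lambda>xs. f xs + g xs)"
  by (rule computable_on_comp2[of "(+)"],
      rule computable_on_prim_rec2[where f = "\<lambda>x. x" and g = "\<lambda>m y x. Suc y"])
    (auto intro!: computable_on_nth computable_on_Suc)

lemma computable_on_mult:
  "computable_on k f \<Longrightarrow> computable_on k g \<Longrightarrow> computable_on k (\<lambda>xs. f xs * g xs)"
  by (rule computable_on_comp2[of "(*)"],
      rule computable_on_prim_rec2[where f = "\<lambda>x. 0" and g = "\<lambda>m y x. x + y"])
    (auto intro!: computable_on_nth computable_on_const computable_on_add)

text \<open>The recursion scheme used here is binary, so the predecessor gets a dummy second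
  argument, for which \<open>f\<close> is inserted again.\<close>

lemma computable_on_pred: "computable_on k f \<Longrightarrow> computable_on k (\<lambda>xs. f xs - 1)"
  by (rule computable_on_comp2[of "\<lambda>m x. m - 1" k f f],
      rule computable_on_prim_rec2[where f = "\<lambda>x. 0" and g = "\<lambda>m y x. m"])
    (auto intro: computable_on_nth computable_on_const)

text \<open>Recursion runs over the subtrahend and iterates the predecessor; hence the arguments are
  swapped.\<close>

lemma computable_on_diff:
  assumes "computable_on k f" and "computable_on k g"
  shows "computable_on k (\<lambda>xs. f xs - g xs)"
  by (rule computable_on_comp2[of "\<lambda>m x. x - m" k g f],
      rule computable_on_prim_rec2[where f = "\<lambda>x. x" and g = "\<lambda>m y x. y - 1"])
    (use assms in \<open>auto intro!: computable_on_nth computable_on_pred[unfolded One_nat_def]\<close>)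

lemma computable_on_triangle: "computable_on k f \<Longrightarrow> computable_on k (\<lambda>xs. triangle (f xs))"
  by (rule computable_on_comp2[of "\<lambda>m x. triangle m" k f f],
      rule computable_on_prim_rec2[where f = "\<lambda>x. 0" and g = "\<lambda>m y x. y + Suc m"])
    (auto intro!: computable_on_nth computable_on_const computable_on_add computable_on_Suc)

lemma computable_on_Least:
  assumes "computable_on (Suc k) f" and "\<And>xs. length xs = k \<Longrightarrow> \<exists>m. f (m # xs) = 0"
  shows "computable_on k (\<lambda>xs. LEAST m. f (m # xs) = 0)"
proof -
  obtain r where r: "\<And>xs. length xs = Suc k \<Longrightarrow> evaluates r xs (f xs)"
    using assms(1) unfolding computable_on_def by blast
  have "evaluates (Mu r) xs (LEAST m. f (m # xs) = 0)" if len: "length xs = k" for xs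
  proof (rule evaluates.Mu)
    show "evaluates r ((LEAST m. f (m # xs) = 0) # xs) 0"
      using r[of "(LEAST m. f (m # xs) = 0) # xs"] LeastI_ex[OF assms(2)[OF len]] len by simp
    show "\<forall>i<LEAST m. f (m # xs) = 0. \<exists>y. evaluates r (i # xs) (Suc y)"
    proof (intro allI impI)
      fix i assume "i < (LEAST m. f (m # xs) = 0)"
      then have "f (i # xs) \<noteq> 0"
        by (rule not_less_Least)
      then obtain y where "f (i # xs) = Suc y"
        using not0_implies_Suc by blast
      then show "\<exists>y. evaluates r (i # xs) (Suc y)"
        using r[of "i # xs"] len by auto
    qed
  qed
  then show ?thesis
    unfolding computable_on_def by blast
qed

section \<open>Pairs and finite sequences of natural numbers\<close>

definition pr :: "nat \<Rightarrow> nat \<Rightarrow> nat" where "pr x y = prod_encode (x, y)"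
definition pfst :: "nat \<Rightarrow> nat" where "pfst p = fst (prod_decode p)"
definition psnd :: "nat \<Rightarrow> nat" where "psnd p = snd (prod_decode p)"

lemma pfst_pr [simp]: "pfst (pr x y) = x" and psnd_pr [simp]: "psnd (pr x y) = y"
  and pr_pfst_psnd [simp]: "pr (pfst p) (psnd p) = p"
  by (simp_all add: pr_def pfst_def psnd_def)

lemma pr_inject [simp]: "pr x y = pr x' y' \<longleftrightarrow> x = x' \<and> y = y'"
  by (simp add: pr_def)

lemma computable_on_pr:
  "computable_on k f \<Longrightarrow> computable_on k g \<Longrightarrow> computable_on k (\<lambda>xs. pr (f xs) (g xs))"
  unfolding pr_def prod_encode_def
  by (auto intro!: computable_on_add computable_on_triangle)

text \<open>\<open>p = pr x y\<close> lies on the diagonal \<open>x + y\<close>, the least \<open>d\<close> with \<open>p < triangle (Suc d)\<close>.\<close>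

lemma diagonal_eq_Least: "pfst p + psnd p = (LEAST d. Suc p - triangle (Suc d) = 0)"
proof (rule Least_equality[symmetric])
  have p: "p = triangle (pfst p + psnd p) + pfst p"
    using pr_pfst_psnd[of p] by (simp add: pr_def prod_encode_def)
  then show "Suc p - triangle (Suc (pfst p + psnd p)) = 0"
    by simp
  fix d assume d: "Suc p - triangle (Suc d) = 0"
  show "pfst p + psnd p \<le> d"
  proof (rule ccontr)
    assume "\<not> ?thesis"
    moreover have "triangle i \<le> triangle j" if "i \<le> j" for i j
      using that by (induction rule: dec_induct) simp_all
    ultimately have "triangle (Suc d) \<le> triangle (pfst p + psnd p)"
      by (meson not_less Suc_leI)
    then show False
      using d p by linarith
  qed
qed

lemma computable_diagonal: "computable (\<lambda>p. pfst p + psnd p)"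
proof -
  have "computable_on 1 (\<lambda>xs. LEAST d. Suc ((d # xs) ! 1) - triangle (Suc ((d # xs) ! 0)) = 0)"
  proof (rule computable_on_Least[where f = "\<lambda>xs. Suc (xs ! 1) - triangle (Suc (xs ! 0))"])
    show "computable_on (Suc 1) (\<lambda>xs. Suc (xs ! 1) - triangle (Suc (xs ! 0)))"
      by (intro computable_on_diff computable_on_triangle computable_on_Suc computable_on_nth) auto
    \<comment> \<open>The search terminates by \<open>d = p\<close> at the latest, as
      \<open>triangle (Suc p)\<close> is at least \<open>Suc p\<close>.\<close>
    show "\<exists>m. Suc ((m # xs) ! 1) - triangle (Suc ((m # xs) ! 0)) = 0" for xs :: "nat list"
      by (rule exI[of _ "xs ! 0"]) simp
  qed
  then show ?thesis
    unfolding computable_iff_computable_on diagonal_eq_Least by (simp del: triangle_Suc)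
qed

section \<open>Closure properties of unary computable functions\<close>

lemma computable_comp: "computable f \<Longrightarrow> computable g \<Longrightarrow> computable (\<lambda>x. f (g x))"
  unfolding computable_iff_computable_on[of g] computable_iff_computable_on[of "\<lambda>x. f (g x)"]
  by (rule computable_on_comp1)

lemma computable_comp2:
  assumes "computable_on 2 (\<lambda>xs. F (xs ! 0) (xs ! 1))" and "computable f" and "computable g"
  shows "computable (\<lambda>x. F (f x) (g x))"
  using assms(2,3) unfolding computable_iff_computable_on by (rule computable_on_comp2[OF assms(1)])

lemma computable_id: "computable (\<lambda>x. x)"
  by (auto simp: computable_iff_computable_on intro: computable_on_nth)

lemma computable_const: "computable (\<lambda>x. c)"
  by (simp add: computable_iff_computable_on computable_on_const)

lemma computable_Suc: "computable f \<Longrightarrow> computable (\<lambda>x. Suc (f x))"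
  by (simp add: computable_iff_computable_on computable_on_Suc)

lemma computable_diff: "computable f \<Longrightarrow> computable g \<Longrightarrow> computable (\<lambda>x. f x - g x)"
  by (simp add: computable_iff_computable_on computable_on_diff)

lemma computable_mult: "computable f \<Longrightarrow> computable g \<Longrightarrow> computable (\<lambda>x. f x * g x)"
  by (simp add: computable_iff_computable_on computable_on_mult)

lemma computable_pr: "computable f \<Longrightarrow> computable g \<Longrightarrow> computable (\<lambda>x. pr (f x) (g x))"
  by (simp add: computable_iff_computable_on computable_on_pr)

text \<open>Cantor's pairing is inverted from the diagonal \<open>d\<close>: the first component is
  \<open>p - triangle d\<close>, the second is what remains of \<open>d\<close>.\<close>

lemma computable_pfst_psnd_aux: "computable pfst" "computable psnd"
proof -
  have "pfst p = p - triangle (pfst p + psnd p)" for p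
    using pr_pfst_psnd[of p] by (simp add: pr_def prod_encode_def)
  moreover have "computable (\<lambda>p. p - triangle (pfst p + psnd p))"
    using computable_diagonal
    by (auto simp: computable_iff_computable_on
        intro!: computable_on_diff computable_on_nth
          computable_on_triangle[of _ "\<lambda>xs. pfst (xs ! 0) + psnd (xs ! 0)"])
  ultimately show *: "computable pfst"
    by simp
  have "computable (\<lambda>p. (pfst p + psnd p) - pfst p)"
    by (intro computable_diff computable_diagonal *)
  then show "computable psnd"
    by simp
qed

lemma computable_pfst: "computable f \<Longrightarrow> computable (\<lambda>x. pfst (f x))"
  and computable_psnd: "computable f \<Longrightarrow> computable (\<lambda>x. psnd (f x))"
  by (simp_all add: computable_comp computable_pfst_psnd_aux)

text \<open>Iterated unpairing makes every number a code of an infinite sequence, so codes need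
  neither a length nor a validity test.\<close>

definition seq_nth :: "nat \<Rightarrow> nat \<Rightarrow> nat" where
  "seq_nth s i = pfst ((psnd ^^ i) s)"

definition seq_enc :: "nat list \<Rightarrow> nat" where
  "seq_enc xs = foldr pr xs 0"

definition seq_take :: "nat \<Rightarrow> nat \<Rightarrow> nat list" where
  "seq_take k s = map (seq_nth s) [0..<k]"

lemma seq_nth_0 [simp]: "seq_nth s 0 = pfst s"
  and seq_nth_Suc [simp]: "seq_nth s (Suc i) = seq_nth (psnd s) i"
  by (simp_all add: seq_nth_def funpow_swap1)

lemma seq_enc_simps [simp]: "seq_enc [] = 0" "seq_enc (x # xs) = pr x (seq_enc xs)"
  by (simp_all add: seq_enc_def)

lemma seq_nth_seq_enc: "i < length xs \<Longrightarrow> seq_nth (seq_enc xs) i = xs ! i"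
  by (induction xs arbitrary: i) (auto simp: less_Suc_eq_0_disj)

lemma seq_take_Suc: "seq_take (Suc k) s = pfst s # seq_take k (psnd s)"
  unfolding seq_take_def by (rule nth_equalityI) (auto simp: nth_Cons simp del: upt_Suc split: nat.split)

lemma length_seq_take [simp]: "length (seq_take k s) = k"
  by (simp add: seq_take_def)

lemma computable_seq_nth:
  assumes "computable f" and "computable g"
  shows "computable (\<lambda>x. seq_nth (f x) (g x))"
  unfolding seq_nth_def
  by (intro computable_pfst computable_comp2[of "\<lambda>i s. (psnd ^^ i) s", OF _ assms(2,1)],
      rule computable_on_prim_rec2[where f = "\<lambda>x. x" and g = "\<lambda>m y x. psnd y"])
    (auto intro!: computable_on_nth computable_on_comp1[OF computable_pfst_psnd_aux(2)])

lemma computable_on_seq_enc: "computable_on k seq_enc"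
proof -
  \<comment> \<open>The arity \<open>k\<close> stays fixed; the induction is on the length
    \<open>j\<close> of the suffix encoded so far.\<close>
  have "j \<le> k \<Longrightarrow> computable_on k (\<lambda>xs. seq_enc (drop (k - j) xs))" for j
  proof (induction j)
    case 0
    have "computable_on k (\<lambda>_. 0)"
      by (rule computable_on_const)
    then show ?case
      by (rule computable_on_cong) simp
  next
    case (Suc j)
    then have "computable_on k (\<lambda>xs. pr (xs ! (k - Suc j)) (seq_enc (drop (k - j) xs)))"
      by (intro computable_on_pr computable_on_nth) auto
    then show ?case
    proof (rule computable_on_cong)
      fix xs :: "nat list" assume "length xs = k"
      then show "pr (xs ! (k - Suc j)) (seq_enc (drop (k - j) xs)) = seq_enc (drop (k - Suc j) xs)"
        using Suc.prems Cons_nth_drop_Suc[of "k - Suc j" xs]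
        by (metis Suc_diff_Suc Suc_le_lessD diff_less less_le_trans seq_enc_simps(2) zero_less_Suc)
    qed
  qed
  from this[of k] show ?thesis
    by simp
qed

section \<open>Decidable predicates and the arithmetical hierarchy\<close>

definition decidable :: "(nat \<Rightarrow> bool) \<Rightarrow> bool" where
  "decidable P \<longleftrightarrow> computable (\<lambda>x. of_bool (P x))"

lemma decidable_not:
  assumes "decidable P"
  shows "decidable (\<lambda>x. \<not> P x)"
proof -
  have "computable (\<lambda>x. 1 - of_bool (P x))"
    using assms unfolding decidable_def by (intro computable_diff computable_const)
  moreover have "1 - of_bool (P x) = (of_bool (\<not> P x) :: nat)" for x
    by simp
  ultimately show ?thesis
    unfolding decidable_def by simp
qed

lemma decidable_conj: "decidable P \<Longrightarrow> decidable Q \<Longrightarrow> decidable (\<lambda>x. P x \<and> Q x)"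
  unfolding decidable_def of_bool_conj by (rule computable_mult)

lemma decidable_comp: "decidable P \<Longrightarrow> computable f \<Longrightarrow> decidable (\<lambda>x. P (f x))"
  unfolding decidable_def by (rule computable_comp)

lemma decidable_less:
  assumes "computable f" and "computable g"
  shows "decidable (\<lambda>x. f x < g x)"
proof -
  have "computable (\<lambda>x. 1 - (Suc (f x) - g x))"
    by (intro computable_diff computable_Suc computable_const assms)
  moreover have "1 - (Suc (f x) - g x) = of_bool (f x < g x)" for x
    by auto
  ultimately show ?thesis
    unfolding decidable_def by simp
qed

lemma decidable_eq:
  assumes "computable f" and "computable g"
  shows "decidable (\<lambda>x. f x = g x)"
proof -
  have "decidable (\<lambda>x. \<not> f x < g x \<and> \<not> g x < f x)"
    by (intro decidable_conj decidable_not decidable_less assms)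
  then show ?thesis
    by (simp add: not_less eq_iff conj_commute)
qed

text \<open>The characteristic function is a product of characteristic functions, hence primitive
  recursive in the bound.\<close>

lemma decidable_ball:
  assumes "decidable (\<lambda>p. P (pfst p) (psnd p))" and "computable t"
  shows "decidable (\<lambda>x. \<forall>i<t x. P i x)"
  unfolding decidable_def
proof (rule computable_comp2[OF _ assms(2) computable_id])
  show "computable_on 2 (\<lambda>xs. of_bool (\<forall>i<xs ! 0. P i (xs ! 1)))"
  proof (rule computable_on_prim_rec2[where f = "\<lambda>x. 1" and g = "\<lambda>m y x. y * of_bool (P m x)"])
    have "computable_on 3 (\<lambda>xs. of_bool (P (pfst (pr (xs ! 0) (xs ! 2))) (psnd (pr (xs ! 0) (xs ! 2)))))"
      using assms(1)[unfolded decidable_def]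
      by (rule computable_on_comp1) (auto intro!: computable_on_pr computable_on_nth)
    then show "computable_on 3 (\<lambda>xs. xs ! 1 * of_bool (P (xs ! 0) (xs ! 2)))"
      by (auto intro!: computable_on_mult computable_on_nth)
  qed (auto simp: computable_on_const less_Suc_eq)
qed

text \<open>\<open>Sigma_set m P\<close> means that \<open>P\<close> is \<open>\<Sigma>\<^sub>m\<close>; that it is \<open>\<Pi>\<^sub>m\<close> is expressed
  by \<open>Sigma_set m (\<lambda>x. \<not> P x)\<close>. Several arguments are combined by pairing, which makes all
  closure properties syntax-directed.\<close>

fun Sigma_set :: "nat \<Rightarrow> (nat \<Rightarrow> bool) \<Rightarrow> bool" where
  "Sigma_set 0 P \<longleftrightarrow> decidable P"
| "Sigma_set (Suc m) P \<longleftrightarrow> (\<exists>Q. Sigma_set m Q \<and> (\<forall>x. P x \<longleftrightarrow> (\<exists>z. \<not> Q (pr z x))))"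

declare Sigma_set.simps(2) [simp del]

lemma Sigma_set_SucI:
  "Sigma_set m Q \<Longrightarrow> (\<And>x. P x \<longleftrightarrow> (\<exists>z. \<not> Q (pr z x))) \<Longrightarrow> Sigma_set (Suc m) P"
  by (auto simp: Sigma_set.simps(2))

lemma Sigma_set_SucE:
  assumes "Sigma_set (Suc m) P"
  obtains Q where "Sigma_set m Q" and "\<And>x. P x \<longleftrightarrow> (\<exists>z. \<not> Q (pr z x))"
  using assms by (auto simp: Sigma_set.simps(2))

lemma Sigma_set_comp: "Sigma_set m P \<Longrightarrow> computable f \<Longrightarrow> Sigma_set m (\<lambda>x. P (f x))"
proof (induction m arbitrary: P f)
  case 0
  then show ?case
    by (simp add: decidable_comp)
next
  case (Suc m)
  obtain Q where Q: "Sigma_set m Q" "\<And>x. P x \<longleftrightarrow> (\<exists>z. \<not> Q (pr z x))"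
    using Suc.prems(1) by (rule Sigma_set_SucE) blast
  have "Sigma_set m (\<lambda>p. Q (pr (pfst p) (f (psnd p))))"
    by (rule Suc.IH[OF Q(1)])
      (intro computable_pr computable_pfst computable_id computable_comp[OF Suc.prems(2)] computable_psnd)
  then show ?case
    by (rule Sigma_set_SucI) (simp add: Q(2))
qed

lemma Sigma_set_Suc_not:
  assumes "Sigma_set m P"
  shows "Sigma_set (Suc m) (\<lambda>x. \<not> P x)"
  by (rule Sigma_set_SucI[OF Sigma_set_comp[OF assms computable_psnd[OF computable_id]]]) simp

text \<open>The dummy quantifier goes innermost, since in front it would break the alternation. At
  the decidable matrix, closure under complement makes up for the negation.\<close>

lemma Sigma_set_Suc: "Sigma_set m P \<Longrightarrow> Sigma_set (Suc m) P"
proof (induction m arbitrary: P)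
  case 0
  then show ?case
    using Sigma_set_Suc_not[of 0 "\<lambda>x. \<not> P x"] decidable_not[of P]
    by (simp only: Sigma_set.simps(1) not_not)
next
  case (Suc m)
  obtain Q where Q: "Sigma_set m Q" "\<And>x. P x \<longleftrightarrow> (\<exists>z. \<not> Q (pr z x))"
    using Suc.prems by (rule Sigma_set_SucE) blast
  show ?case
    by (rule Sigma_set_SucI[OF Suc.IH[OF Q(1)] Q(2)])
qed

lemma Sigma_set_mono: "m \<le> n \<Longrightarrow> Sigma_set m P \<Longrightarrow> Sigma_set n P"
  by (induction rule: dec_induct) (auto intro: Sigma_set_Suc)

lemma Sigma_set_not_mono: "m < n \<Longrightarrow> Sigma_set m P \<Longrightarrow> Sigma_set n (\<lambda>x. \<not> P x)"
  by (rule Sigma_set_mono[OF Suc_leI Sigma_set_Suc_not])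

lemma Sigma_set_decidable: "decidable P \<Longrightarrow> Sigma_set m P"
  by (rule Sigma_set_mono[of 0]) auto

text \<open>Each level negates its matrix, so a conjunction leads to a disjunction one level below
  and conversely; the two must be proved together. Conjunction needs a pair of witnesses,
  disjunction a single one.\<close>

lemma Sigma_set_conj_disj:
  assumes "Sigma_set m P" and "Sigma_set m Q"
  shows "Sigma_set m (\<lambda>x. P x \<and> Q x) \<and> Sigma_set m (\<lambda>x. P x \<or> Q x)"
  using assms
proof (induction m arbitrary: P Q)
  case 0
  then show ?case
    using decidable_not[OF decidable_conj[OF decidable_not[of P] decidable_not[of Q]]]
    by (simp add: decidable_conj)
next
  case (Suc m)
  obtain P' where P': "Sigma_set m P'" "\<And>x. P x \<longleftrightarrow> (\<exists>z. \<not> P' (pr z x))"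
    using Suc.prems(1) by (rule Sigma_set_SucE) blast
  obtain Q' where Q': "Sigma_set m Q'" "\<And>x. Q x \<longleftrightarrow> (\<exists>z. \<not> Q' (pr z x))"
    using Suc.prems(2) by (rule Sigma_set_SucE) blast
  have "Sigma_set m (\<lambda>p. P' (pr (pfst (pfst p)) (psnd p)))"
    "Sigma_set m (\<lambda>p. Q' (pr (psnd (pfst p)) (psnd p)))"
    by (rule Sigma_set_comp[OF P'(1)] Sigma_set_comp[OF Q'(1)],
        intro computable_pr computable_pfst computable_psnd computable_id)+
  then have "Sigma_set m (\<lambda>p. P' (pr (pfst (pfst p)) (psnd p)) \<or> Q' (pr (psnd (pfst p)) (psnd p)))"
    using Suc.IH by blast
  moreover have "P x \<and> Q x \<longleftrightarrow>
      (\<exists>z. \<not> (P' (pr (pfst (pfst (pr z x))) (psnd (pr z x))) \<or>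
             Q' (pr (psnd (pfst (pr z x))) (psnd (pr z x)))))" for x
    by (simp add: P'(2) Q'(2)) (metis pfst_pr psnd_pr)
  ultimately have "Sigma_set (Suc m) (\<lambda>x. P x \<and> Q x)"
    by (rule Sigma_set_SucI)
  moreover have "Sigma_set (Suc m) (\<lambda>x. P x \<or> Q x)"
    by (rule Sigma_set_SucI[OF conjunct1[OF Suc.IH[OF P'(1) Q'(1)]]]) (auto simp: P'(2) Q'(2))
  ultimately show ?case ..
qed

lemma Sigma_set_conj: "Sigma_set m P \<Longrightarrow> Sigma_set m Q \<Longrightarrow> Sigma_set m (\<lambda>x. P x \<and> Q x)"
  and Sigma_set_disj: "Sigma_set m P \<Longrightarrow> Sigma_set m Q \<Longrightarrow> Sigma_set m (\<lambda>x. P x \<or> Q x)"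
  using Sigma_set_conj_disj by blast+

text \<open>Two adjacent existential quantifiers contract into one over pairs; this needs a leading
  existential quantifier, hence the level \<open>Suc m\<close>.\<close>

lemma Sigma_set_ex:
  assumes "Sigma_set (Suc m) (\<lambda>p. P (pfst p) (psnd p))"
  shows "Sigma_set (Suc m) (\<lambda>x. \<exists>z. P z x)"
proof -
  obtain Q where Q: "Sigma_set m Q" "\<And>p. P (pfst p) (psnd p) \<longleftrightarrow> (\<exists>z. \<not> Q (pr z p))"
    using assms by (rule Sigma_set_SucE) blast
  have "Sigma_set m (\<lambda>p. Q (pr (pfst (pfst p)) (pr (psnd (pfst p)) (psnd p))))"
    by (rule Sigma_set_comp[OF Q(1)])
      (intro computable_pr computable_pfst computable_psnd computable_id)
  moreover have "(\<exists>z. P z x) \<longleftrightarrow>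
      (\<exists>z. \<not> Q (pr (pfst (pfst (pr z x))) (pr (psnd (pfst (pr z x))) (psnd (pr z x)))))" for x
    using Q(2)[of "pr _ x"] by simp (metis pfst_pr psnd_pr)
  ultimately show ?thesis
    by (rule Sigma_set_SucI)
qed

text \<open>Finite choice with the chosen values packed into one number; this lets a bounded
  universal quantifier pass an existential one.\<close>

lemma choice_seq: "(\<forall>i<t. \<exists>z. P i z) \<longleftrightarrow> (\<exists>s. \<forall>i<t. P i (seq_nth s i))" for t :: nat
proof
  assume "\<forall>i<t. \<exists>z. P i z"
  then obtain c where "\<forall>i<t. P i (c i)"
    by metis
  then have "\<forall>i<t. P i (seq_nth (seq_enc (map c [0..<t])) i)"
    by (simp add: seq_nth_seq_enc)
  then show "\<exists>s. \<forall>i<t. P i (seq_nth s i)" ..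
qed auto

text \<open>A bounded quantifier is moved inwards past the leading existential quantifier, and through
  the negation it turns into its dual.\<close>

lemma Sigma_set_ball_bex:
  assumes "Sigma_set m (\<lambda>p. P (pfst p) (psnd p))" and "computable t"
  shows "Sigma_set m (\<lambda>x. \<forall>i<t x. P i x) \<and> Sigma_set m (\<lambda>x. \<exists>i<t x. P i x)"
  using assms
proof (induction m arbitrary: P t)
  case 0
  have "decidable (\<lambda>x. \<not> (\<forall>i<t x. \<not> P i x))"
    using 0 by (intro decidable_not decidable_ball) auto
  with 0 show ?case
    by (simp add: decidable_ball)
next
  case (Suc m)
  obtain Q where Q: "Sigma_set m Q" "\<And>p. P (pfst p) (psnd p) \<longleftrightarrow> (\<exists>z. \<not> Q (pr z p))"
    using Suc.prems(1) by (rule Sigma_set_SucE) blast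
  have P: "P i x \<longleftrightarrow> (\<exists>z. \<not> Q (pr z (pr i x)))" for i x
    using Q(2)[of "pr i x"] by simp
  have t: "computable (\<lambda>p. t (psnd p))"
    by (intro computable_comp[OF Suc.prems(2)] computable_psnd computable_id)
  have "Sigma_set m (\<lambda>p. Q (pr (seq_nth (pfst (psnd p)) (pfst p)) (pr (pfst p) (psnd (psnd p)))))"
    by (rule Sigma_set_comp[OF Q(1)])
      (intro computable_pr computable_seq_nth computable_pfst computable_psnd computable_id)
  then have "Sigma_set m (\<lambda>p. \<exists>i<t (psnd p). Q (pr (seq_nth (pfst p) i) (pr i (psnd p))))"
    using Suc.IH[OF _ t, of "\<lambda>i p. Q (pr (seq_nth (pfst p) i) (pr i (psnd p)))"] by simp
  moreover have "(\<forall>i<t x. P i x) \<longleftrightarrow>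
      (\<exists>s. \<not> (\<exists>i<t (psnd (pr s x)). Q (pr (seq_nth (pfst (pr s x)) i) (pr i (psnd (pr s x))))))" for x
    using choice_seq[of "t x" "\<lambda>i z. \<not> Q (pr z (pr i x))"] by (simp add: P)
  ultimately have ball: "Sigma_set (Suc m) (\<lambda>x. \<forall>i<t x. P i x)"
    by (rule Sigma_set_SucI)
  have "Sigma_set m (\<lambda>p. Q (pr (pfst (psnd p)) (pr (pfst p) (psnd (psnd p)))))"
    by (rule Sigma_set_comp[OF Q(1)])
      (intro computable_pr computable_pfst computable_psnd computable_id)
  then have "Sigma_set m (\<lambda>p. \<forall>i<t (psnd p). Q (pr (pfst p) (pr i (psnd p))))"
    using Suc.IH[OF _ t, of "\<lambda>i p. Q (pr (pfst p) (pr i (psnd p)))"] by simp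
  moreover have "(\<exists>i<t x. P i x) \<longleftrightarrow>
      (\<exists>z. \<not> (\<forall>i<t (psnd (pr z x)). Q (pr (pfst (pr z x)) (pr i (psnd (pr z x))))))" for x
    by (auto simp: P)
  ultimately have "Sigma_set (Suc m) (\<lambda>x. \<exists>i<t x. P i x)"
    by (rule Sigma_set_SucI)
  with ball show ?case ..
qed

lemma Sigma_set_ball:
  "Sigma_set m (\<lambda>p. P (pfst p) (psnd p)) \<Longrightarrow> computable t \<Longrightarrow> Sigma_set m (\<lambda>x. \<forall>i<t x. P i x)"
  and Sigma_set_bex:
  "Sigma_set m (\<lambda>p. P (pfst p) (psnd p)) \<Longrightarrow> computable t \<Longrightarrow> Sigma_set m (\<lambda>x. \<exists>i<t x. P i x)"
  using Sigma_set_ball_bex by blast+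

lemma Sigma_set_eq: "computable f \<Longrightarrow> computable g \<Longrightarrow> Sigma_set m (\<lambda>x. f x = g x)"
  by (intro Sigma_set_decidable decidable_eq)

text \<open>\<open>H\<close> holds where a witness for \<open>A\<close> appears no later than the first witness for \<open>B\<close>.\<close>

lemma Sigma_set_reduction:
  assumes "Sigma_set (Suc m) A" and "Sigma_set (Suc m) B" and total: "\<And>x. A x \<or> B x"
  obtains H where "Sigma_set (Suc m) H" and "Sigma_set (Suc m) (\<lambda>x. \<not> H x)"
    and "\<And>x. H x \<Longrightarrow> A x" and "\<And>x. \<not> H x \<Longrightarrow> B x"
proof -
  obtain P where P: "Sigma_set m P" "\<And>x. A x \<longleftrightarrow> (\<exists>z. \<not> P (pr z x))"
    using assms(1) by (rule Sigma_set_SucE) blast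
  obtain Q where Q: "Sigma_set m Q" "\<And>x. B x \<longleftrightarrow> (\<exists>z. \<not> Q (pr z x))"
    using assms(2) by (rule Sigma_set_SucE) blast
  define H where "H x \<longleftrightarrow> (\<exists>w. \<not> P (pr w x) \<and> (\<forall>i<w. Q (pr i x)))" for x
  \<comment> \<open>The bound \<open>Suc w\<close>, against \<open>w\<close> in \<open>H\<close>,
    resolves ties in favour of \<open>A\<close> and makes \<open>H'\<close> the exact complement of
    \<open>H\<close>.\<close>
  define H' where "H' x \<longleftrightarrow> (\<exists>w. \<not> Q (pr w x) \<and> (\<forall>i<Suc w. P (pr i x)))" for x
  have H': "\<not> H x \<longleftrightarrow> H' x" for x
  proof
    assume nH: "\<not> H x"
    have "\<exists>w. \<not> Q (pr w x)"
      using total[of x] nH unfolding H_def P(2) Q(2) by blast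
    then obtain w where w: "\<not> Q (pr w x)" "\<And>i. i < w \<Longrightarrow> Q (pr i x)"
      using exists_least_iff[of "\<lambda>w. \<not> Q (pr w x)"] by blast
    have "P (pr i x)" if "i < Suc w" for i
      using nH w(2) that unfolding H_def by (meson less_Suc_eq_le less_le_trans)
    with w(1) show "H' x"
      unfolding H'_def by blast
  next
    assume "H' x"
    then show "\<not> H x"
      unfolding H_def H'_def by (metis less_Suc_eq not_less_eq)
  qed
  \<comment> \<open>One level up, the matrices and their negations are all available, and the
    bounded quantifiers cost nothing.\<close>
  have *: "Sigma_set (Suc m) (\<lambda>p. \<not> P p)" "Sigma_set (Suc m) (\<lambda>p. \<not> Q p)"
    "Sigma_set (Suc m) P" "Sigma_set (Suc m) Q"
    using P(1) Q(1) by (simp_all add: Sigma_set_Suc Sigma_set_Suc_not)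
  have "Sigma_set (Suc m) H"
    unfolding H_def
    by (intro Sigma_set_ex Sigma_set_conj Sigma_set_ball *[THEN Sigma_set_comp]
        computable_pr computable_pfst computable_psnd computable_id)
  moreover have "Sigma_set (Suc m) (\<lambda>x. \<not> H x)"
    unfolding H' H'_def
    by (intro Sigma_set_ex Sigma_set_conj Sigma_set_ball *[THEN Sigma_set_comp]
        computable_pr computable_pfst computable_psnd computable_id computable_Suc)
  moreover have "A x" if "H x" for x
    using that by (auto simp: H_def P)
  moreover have "B x" if "\<not> H x" for x
    using that unfolding H' by (auto simp: H'_def Q)
  ultimately show thesis
    using that by blast
qed

section \<open>Passage between the hierarchy on argument lists and \<open>Sigma_set\<close> on
  codes\<close>

lemma computable_rel_iff: "computable_rel k R \<longleftrightarrow> computable_on k (\<lambda>xs. of_bool (R xs))"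
  unfolding computable_rel_def computable_on_def of_bool_def by simp

text \<open>Prepending a quantified variable to the list corresponds to pairing it on the left of
  the code, so quantifiers translate one by one. The two claims mirror the mutual recursion of
  \<open>is_Sigma\<close> and \<open>is_Pi\<close>.\<close>

lemma Sigma_set_if_is_Sigma_is_Pi:
  "(is_Sigma m k R \<longrightarrow> Sigma_set m (\<lambda>p. R (seq_take k p))) \<and>
   (is_Pi m k R \<longrightarrow> Sigma_set m (\<lambda>p. \<not> R (seq_take k p)))"
proof (induction m arbitrary: k R)
  case 0
  have "decidable (\<lambda>p. R (seq_take k p))" if "computable_rel k R"
  proof -
    have "computable_on 1 (\<lambda>xs. of_bool (R (map (\<lambda>i. seq_nth (xs ! 0) i) [0..<k])))"
      using that unfolding computable_rel_iff
    proof (rule computable_on_comp)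
      show "computable_on 1 (\<lambda>xs. seq_nth (xs ! 0) i)" for i
        using computable_seq_nth[OF computable_id computable_const[of i]]
        by (simp add: computable_iff_computable_on)
    qed
    then show ?thesis
      by (simp add: decidable_def computable_iff_computable_on seq_take_def)
  qed
  then show ?case
    by (auto intro: decidable_not)
next
  case (Suc m)
  have "Sigma_set (Suc m) (\<lambda>p. R (seq_take k p))"
    if "is_Pi m (Suc k) Q" "\<forall>xs. length xs = k \<longrightarrow> (R xs \<longleftrightarrow> (\<exists>z. Q (z # xs)))" for Q
    by (rule Sigma_set_SucI[of _ "\<lambda>p. \<not> Q (seq_take (Suc k) p)"])
      (use Suc.IH[of "Suc k" Q] that in \<open>auto simp: seq_take_Suc\<close>)
  moreover have "Sigma_set (Suc m) (\<lambda>p. \<not> R (seq_take k p))"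
    if "is_Sigma m (Suc k) Q" "\<forall>xs. length xs = k \<longrightarrow> (R xs \<longleftrightarrow> (\<forall>z. Q (z # xs)))" for Q
    by (rule Sigma_set_SucI[of _ "\<lambda>p. Q (seq_take (Suc k) p)"])
      (use Suc.IH[of "Suc k" Q] that in \<open>auto simp: seq_take_Suc\<close>)
  ultimately show ?case
    unfolding is_Sigma.simps is_Pi.simps by blast
qed

lemma is_Sigma_is_Pi_if_Sigma_set:
  assumes "Sigma_set m P"
  shows "is_Sigma m k (\<lambda>xs. P (seq_enc xs)) \<and> is_Pi m k (\<lambda>xs. \<not> P (seq_enc xs))"
  using assms
proof (induction m arbitrary: k P)
  case 0
  then have "decidable P" "decidable (\<lambda>x. \<not> P x)"
    by (simp_all add: decidable_not)
  then show ?case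
    using computable_on_comp1[OF _ computable_on_seq_enc]
    by (auto simp: computable_rel_iff decidable_def)
next
  case (Suc m)
  obtain Q where Q: "Sigma_set m Q" "\<And>x. P x \<longleftrightarrow> (\<exists>z. \<not> Q (pr z x))"
    using Suc.prems by (rule Sigma_set_SucE) blast
  have "is_Sigma (Suc m) k (\<lambda>xs. P (seq_enc xs))"
    unfolding is_Sigma.simps
    by (rule exI[of _ "\<lambda>xs. \<not> Q (seq_enc xs)"])
      (use Suc.IH[OF Q(1), of "Suc k"] in \<open>simp add: Q(2)\<close>)
  moreover have "is_Pi (Suc m) k (\<lambda>xs. \<not> P (seq_enc xs))"
    unfolding is_Pi.simps
    by (rule exI[of _ "\<lambda>xs. Q (seq_enc xs)"])
      (use Suc.IH[OF Q(1), of "Suc k"] in \<open>simp add: Q(2)\<close>)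
  ultimately show ?case ..
qed

lemma Pi_equiv_iff:
  "Pi_equiv (Suc n) E \<longleftrightarrow> equiv UNIV E \<and> Sigma_set (Suc n) (\<lambda>p. (pfst p, psnd p) \<notin> E)"
proof -
  have "Sigma_set (Suc n) (\<lambda>p. (pfst p, psnd p) \<notin> E)"
    if "is_Pi (Suc n) 2 (\<lambda>xs. (xs ! 0, xs ! 1) \<in> E)"
  proof -
    \<comment> \<open>The list \<open>[x, y]\<close> has the code \<open>pr x (pr y 0)\<close>,
      which differs from the plain pair \<open>pr x y\<close>; a computable substitution converts
      one form into the other.\<close>
    have "Sigma_set (Suc n) (\<lambda>p. (pfst p, pfst (psnd p)) \<notin> E)"
      using mp[OF conjunct2[OF Sigma_set_if_is_Sigma_is_Pi] that]
      by (simp add: numeral_2_eq_2 seq_take_Suc)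
    from Sigma_set_comp[OF this, of "\<lambda>p. pr (pfst p) (pr (psnd p) 0)"] show ?thesis
      by (simp add: computable_pr computable_pfst computable_psnd computable_id computable_const)
  qed
  moreover have "is_Pi (Suc n) 2 (\<lambda>xs. (xs ! 0, xs ! 1) \<in> E)"
    if "Sigma_set (Suc n) (\<lambda>p. (pfst p, psnd p) \<notin> E)"
  proof -
    have "Sigma_set (Suc n) (\<lambda>p. (pfst p, pfst (psnd p)) \<notin> E)"
      using Sigma_set_comp[OF that, of "\<lambda>p. pr (pfst p) (pfst (psnd p))"]
      by (simp add: computable_pr computable_pfst computable_psnd computable_id)
    from conjunct2[OF is_Sigma_is_Pi_if_Sigma_set[OF this, of 2]]
    have "is_Pi (Suc n) 2 (\<lambda>xs. (pfst (seq_enc xs), pfst (psnd (seq_enc xs))) \<in> E)"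
      by simp
    moreover have "(pfst (seq_enc xs), pfst (psnd (seq_enc xs))) = (xs ! 0, xs ! 1)"
      if "length xs = 2" for xs
      using that by (auto simp: numeral_2_eq_2 length_Suc_conv)
    ultimately show ?thesis
      by simp
  qed
  ultimately show ?thesis
    unfolding Pi_equiv_def by blast
qed

section \<open>A universal \<open>\<Sigma>\<^sub>1\<close> relation\<close>

text \<open>An abstract proof system with binary rules. Evaluation of programs will be an instance,
  and coded derivations then bound its complexity without any machine model.\<close>

inductive derivable :: "(nat \<Rightarrow> bool) \<Rightarrow> (nat \<Rightarrow> nat \<Rightarrow> nat \<Rightarrow> bool) \<Rightarrow> nat \<Rightarrow> bool" for A R where
  derivable_axiom: "A c \<Longrightarrow> derivable A R c"
| derivable_step: "derivable A R a \<Longrightarrow> derivable A R b \<Longrightarrow> R a b c \<Longrightarrow> derivable A R c"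

definition derivation :: "(nat \<Rightarrow> bool) \<Rightarrow> (nat \<Rightarrow> nat \<Rightarrow> nat \<Rightarrow> bool) \<Rightarrow> (nat \<Rightarrow> nat) \<Rightarrow> nat \<Rightarrow> bool" where
  "derivation A R s n \<longleftrightarrow>
     (\<forall>i<n. A (s i) \<or> (\<exists>j<i. \<exists>k<i. R (s j) (s k) (s i)))"

lemma derivable_if_derivation:
  assumes "derivation A R s n"
  shows "i < n \<Longrightarrow> derivable A R (s i)"
proof (induction i rule: less_induct)
  case (less i)
  then have "A (s i) \<or> (\<exists>j<i. \<exists>k<i. R (s j) (s k) (s i))"
    using assms unfolding derivation_def by blast
  then show ?case
  proof (elim disjE exE conjE)
    fix j k assume "j < i" "k < i" "R (s j) (s k) (s i)"
    then show ?thesis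
      using less.IH[of j] less.IH[of k] less.prems
      by (intro derivable_step[of A R "s j" "s k" "s i"]) simp_all
  qed (rule derivable_axiom)
qed

lemma derivation_cong:
  assumes "derivation A R s n" and eq: "\<And>i. i < n \<Longrightarrow> s i = t i"
  shows "derivation A R t n"
  unfolding derivation_def
proof (intro allI impI)
  fix i assume i: "i < n"
  then have "A (s i) \<or> (\<exists>j<i. \<exists>k<i. R (s j) (s k) (s i))"
    using assms(1) unfolding derivation_def by blast
  then show "A (t i) \<or> (\<exists>j<i. \<exists>k<i. R (t j) (t k) (t i))"
  proof (elim disjE exE conjE)
    fix j k assume "j < i" "k < i" "R (s j) (s k) (s i)"
    with i eq[of i] eq[of j] eq[of k] show ?thesis
      by auto
  qed (use i eq in simp)
qed

lemma derivation_append: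
  assumes "derivation A R s m" and "derivation A R (\<lambda>i. s (m + i)) n"
  shows "derivation A R s (m + n)"
  unfolding derivation_def
proof (intro allI impI)
  fix i assume i: "i < m + n"
  show "A (s i) \<or> (\<exists>j<i. \<exists>k<i. R (s j) (s k) (s i))"
  proof (cases "i < m")
    case True
    with assms(1) show ?thesis
      unfolding derivation_def by blast
  next
    case False
    define i' where "i' = i - m"
    have i': "i' < n" "i = m + i'"
      using i False by (auto simp: i'_def)
    have "A (s (m + i')) \<or> (\<exists>j<i'. \<exists>k<i'. R (s (m + j)) (s (m + k)) (s (m + i')))"
      using assms(2) i'(1) unfolding derivation_def by blast
    then show ?thesis
      unfolding i'(2) by (meson nat_add_left_cancel_less)
  qed
qed

lemma derivation_if_derivable:
  "derivable A R c \<Longrightarrow> \<exists>xs. derivation A R ((!) xs) (length xs) \<and> c \<in> set xs"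
proof (induction rule: derivable.induct)
  case (derivable_axiom c)
  then have "derivation A R ((!) [c]) (length [c])"
    by (simp add: derivation_def)
  then show ?case
    by (intro exI[of _ "[c]"]) simp
next
  case (derivable_step a b c)
  then obtain xs ys where xs: "derivation A R ((!) xs) (length xs)" "a \<in> set xs"
    and ys: "derivation A R ((!) ys) (length ys)" "b \<in> set ys"
    by blast
  \<comment> \<open>Derivations of the two premises are concatenated and the conclusion is appended;
    a premise found at \<open>k\<close> in \<open>ys\<close> moves to
    \<open>length xs + k\<close>.\<close>
  let ?zs = "xs @ ys @ [c]"
  obtain j k where jk: "j < length xs" "xs ! j = a" "k < length ys" "ys ! k = b"
    using xs(2) ys(2) by (auto simp: in_set_conv_nth)
  have "derivation A R ((!) ?zs) (length xs + length ys)"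
  proof (rule derivation_append)
    show "derivation A R ((!) ?zs) (length xs)"
      using xs(1) by (rule derivation_cong) (simp add: nth_append)
    show "derivation A R (\<lambda>i. ?zs ! (length xs + i)) (length ys)"
      using ys(1) by (rule derivation_cong) (simp add: nth_append)
  qed
  moreover have "R (?zs ! j) (?zs ! (length xs + k)) (?zs ! (length xs + length ys))"
    using jk derivable_step.hyps(3) by (simp add: nth_append)
  then have "\<exists>j<length xs + length ys. \<exists>k<length xs + length ys.
      R (?zs ! j) (?zs ! k) (?zs ! (length xs + length ys))"
    using jk by (intro exI[of _ j] exI[of _ "length xs + k"] conjI) auto
  ultimately have "derivation A R ((!) ?zs) (length ?zs)"
    unfolding derivation_def by
      (auto simp only: length_append list.size add_0 add_Suc_right add_0_right less_Suc_eq)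
  then show ?case
    by (intro exI[of _ ?zs]) simp
qed

lemma derivable_iff:
  "derivable A R c \<longleftrightarrow> (\<exists>s n. derivation A R (seq_nth s) n \<and> (\<exists>i<n. seq_nth s i = c))"
proof
  assume "derivable A R c"
  then obtain xs where xs: "derivation A R ((!) xs) (length xs)" "c \<in> set xs"
    using derivation_if_derivable by blast
  have "derivation A R (seq_nth (seq_enc xs)) (length xs)"
    using xs(1) by (rule derivation_cong) (simp_all add: seq_nth_seq_enc)
  moreover have "\<exists>i<length xs. seq_nth (seq_enc xs) i = c"
    using xs(2) by (auto simp: in_set_conv_nth seq_nth_seq_enc)
  ultimately show "\<exists>s n. derivation A R (seq_nth s) n \<and> (\<exists>i<n. seq_nth s i = c)"
    by blast
qed (auto intro: derivable_if_derivation)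

lemmas computable_intros = computable_pr computable_pfst computable_psnd computable_seq_nth
  computable_Suc computable_id computable_const

text \<open>By \<open>derivable_iff\<close> only the code and the length of the derivation are
  quantified without bound, so derivability stays on the level of \<open>A\<close> and
  \<open>R\<close>.\<close>

lemma Sigma_set_derivable:
  assumes A: "Sigma_set (Suc m) A"
    and "Sigma_set (Suc m) (\<lambda>t. R (pfst t) (pfst (psnd t)) (psnd (psnd t)))"
  shows "Sigma_set (Suc m) (derivable A R)"
proof -
  have R: "Sigma_set (Suc m) (\<lambda>x. R (f x) (g x) (h x))"
    if "computable f" "computable g" "computable h" for f g h
    using Sigma_set_comp[OF assms(2) computable_pr[OF that(1) computable_pr[OF that(2,3)]]] by simp
  have "Sigma_set (Suc m) (\<lambda>c. \<exists>s n. derivation A R (seq_nth s) n \<and> (\<exists>i<n. seq_nth s i = c))"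
    unfolding derivation_def
    by (intro Sigma_set_ex Sigma_set_conj Sigma_set_disj Sigma_set_ball Sigma_set_bex Sigma_set_eq R
        Sigma_set_comp[OF A]
        computable_intros)
  then show ?thesis
    by (simp add: derivable_iff[abs_def])
qed

text \<open>Argument lists are represented by \<open>seq_enc\<close>, that is, without their length, and a list of
  functions is represented by the single function returning the encoded list of their values. So
  programs become unary; \<open>code_search\<close> is the unbounded search that starts at the first component
  of its argument.\<close>

abbreviation code_zero :: nat where "code_zero \<equiv> pr 0 0"
abbreviation code_succ :: nat where "code_succ \<equiv> pr 2 0"
abbreviation code_proj :: "nat \<Rightarrow> nat" where "code_proj i \<equiv> pr 3 i"
abbreviation code_comp :: "nat \<Rightarrow> nat \<Rightarrow> nat" where "code_comp f g \<equiv> pr 4 (pr f g)"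
abbreviation code_cons :: "nat \<Rightarrow> nat \<Rightarrow> nat" where "code_cons f g \<equiv> pr 5 (pr f g)"
abbreviation code_rec :: "nat \<Rightarrow> nat \<Rightarrow> nat" where "code_rec f g \<equiv> pr 6 (pr f g)"
abbreviation code_search :: "nat \<Rightarrow> nat" where "code_search f \<equiv> pr 7 f"
abbreviation code_mu :: "nat \<Rightarrow> nat" where "code_mu f \<equiv> pr 8 f"

abbreviation judgement :: "nat \<Rightarrow> nat \<Rightarrow> nat \<Rightarrow> nat" where
  "judgement e x y \<equiv> pr e (pr x y)"

definition run_axiom :: "nat \<Rightarrow> bool" where
  "run_axiom c \<longleftrightarrow>
     (\<exists>x. c = judgement code_zero x 0) \<or>
     (\<exists>x. c = judgement code_succ x (Suc (pfst x))) \<or>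
     (\<exists>i x. c = judgement (code_proj i) x (seq_nth x i))"

text \<open>In the rules with a single premise, \<open>b\<close> is left unconstrained; it can be any derivable
  judgement, for example \<open>a\<close> itself.\<close>

definition run_rule :: "nat \<Rightarrow> nat \<Rightarrow> nat \<Rightarrow> bool" where
  "run_rule a b c \<longleftrightarrow>
     (\<exists>f g x y z. a = judgement g x y \<and> b = judgement f y z \<and> c = judgement (code_comp f g) x z) \<or>
     (\<exists>f g x y z. a = judgement f x y \<and> b = judgement g x z \<and>
        c = judgement (code_cons f g) x (pr y z)) \<or>
     (\<exists>f g x y. a = judgement f x y \<and> c = judgement (code_rec f g) (pr 0 x) y) \<or>
     (\<exists>f g m x y z. a = judgement (code_rec f g) (pr m x) y \<and> b = judgement g (pr m (pr y x)) z \<and>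
        c = judgement (code_rec f g) (pr (Suc m) x) z) \<or>
     (\<exists>f m x. a = judgement f (pr m x) 0 \<and> c = judgement (code_search f) (pr m x) m) \<or>
     (\<exists>f m x y z. a = judgement f (pr m x) (Suc y) \<and> b = judgement (code_search f) (pr (Suc m) x) z \<and>
        c = judgement (code_search f) (pr m x) z) \<or>
     (\<exists>f x y. a = judgement (code_search f) (pr 0 x) y \<and> c = judgement (code_mu f) x y)"

definition run :: "nat \<Rightarrow> nat \<Rightarrow> nat \<Rightarrow> bool" where
  "run e x y \<longleftrightarrow> derivable run_axiom run_rule (judgement e x y)"

lemma Sigma_set_run: "Sigma_set (Suc m) (\<lambda>t. run (pfst t) (pfst (psnd t)) (psnd (psnd t)))"
proof -
  have "Sigma_set (Suc m) (derivable run_axiom run_rule)"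
    unfolding run_axiom_def run_rule_def
    by (intro Sigma_set_derivable Sigma_set_ex Sigma_set_conj Sigma_set_disj Sigma_set_eq
        computable_intros)
  then show ?thesis
    by (simp add: run_def)
qed

text \<open>Inversion of the last derivation step: the tags of the codes are distinct, so only the
  axioms or rules for the given code can produce the judgement.\<close>

lemma run_simps:
  "run code_zero x y \<longleftrightarrow> y = 0"
  "run code_succ x y \<longleftrightarrow> y = Suc (pfst x)"
  "run (code_proj i) x y \<longleftrightarrow> y = seq_nth x i"
  "run (code_comp f g) x z \<longleftrightarrow> (\<exists>y. run g x y \<and> run f y z)"
  "run (code_cons f g) x w \<longleftrightarrow> (\<exists>y z. run f x y \<and> run g x z \<and> w = pr y z)"
  "run (code_rec f g) (pr 0 x) y \<longleftrightarrow> run f x y"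
  "run (code_rec f g) (pr (Suc m) x) z \<longleftrightarrow>
     (\<exists>y. run (code_rec f g) (pr m x) y \<and> run g (pr m (pr y x)) z)"
  "run (code_search f) (pr m x) y \<longleftrightarrow>
     run f (pr m x) 0 \<and> y = m \<or>
     (\<exists>v. run f (pr m x) (Suc v) \<and> run (code_search f) (pr (Suc m) x) y)"
  "run (code_mu f) x y \<longleftrightarrow> run (code_search f) (pr 0 x) y"
  unfolding run_def by (subst derivable.simps, (auto simp: run_axiom_def run_rule_def)[1])+

section \<open>Translation of \<open>recf\<close> expressions into program codes\<close>

primrec recf_code :: "recf \<Rightarrow> nat" where
  "recf_code Zero = code_zero"
| "recf_code Succ = code_succ"
| "recf_code (Proj i) = code_proj i"
| "recf_code (Comp f gs) = code_comp (recf_code f) (foldr code_cons (map recf_code gs) code_zero)"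
| "recf_code (PrimRec f g) = code_rec (recf_code f) (recf_code g)"
| "recf_code (Mu f) = code_mu (recf_code f)"

text \<open>The fold ends in \<open>code_zero\<close> because \<open>0\<close> encodes the empty
  list.\<close>

lemma run_code_cons_list:
  assumes "list_all2 (\<lambda>g y. \<forall>z. run (recf_code g) x z \<longleftrightarrow> z = y) gs ys"
  shows "run (foldr code_cons (map recf_code gs) code_zero) x z \<longleftrightarrow> z = seq_enc ys"
  using assms by (induction arbitrary: z rule: list_all2_induct) (simp_all add: run_simps)

text \<open>The equivalence, for arbitrary \<open>z\<close>, yields existence and uniqueness of the
  result at once, so determinism of \<open>run\<close> needs no separate proof. Nothing is claimed
  about diverging expressions.\<close>

lemma run_recf_code: "evaluates r xs y \<Longrightarrow> run (recf_code r) (seq_enc xs) z \<longleftrightarrow> z = y"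
proof (induction arbitrary: z rule: evaluates.induct)
  case (Comp xs gs ys f y)
  have "list_all2 (\<lambda>g y. \<forall>z. run (recf_code g) (seq_enc xs) z \<longleftrightarrow> z = y) gs ys"
    using Comp.IH(1) by (auto elim: list_all2_mono)
  from run_code_cons_list[OF this] show ?case
    by (simp add: run_simps Comp.IH)
next
  case (Mu f m xs)
  \<comment> \<open>Downward induction from the minimum: a search started at any \<open>i\<close> up
    to \<open>m\<close> returns \<open>m\<close>. The case \<open>i = 0\<close> is the
    minimisation.\<close>
  have "run (code_search (recf_code f)) (pr i (seq_enc xs)) z \<longleftrightarrow> z = m" if "i \<le> m" for i
    using that
  proof (induction i rule: inc_induct)
    case base
    show ?case
      using Mu.IH(1) by (subst run_simps) auto
  next
    case (step i)
    from step.hyps Mu.IH(2) obtain v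
      where v: "\<And>z. run (recf_code f) (pr i (seq_enc xs)) z \<longleftrightarrow> z = Suc v"
      by auto
    show ?case
      by (subst run_simps) (simp add: v step.IH)
  qed
  then show ?case
    by (simp add: run_simps(9))
qed (simp_all add: run_simps seq_nth_seq_enc)

corollary computable_run:
  assumes "computable f"
  obtains e where "\<And>x y. run e (pr x 0) y \<longleftrightarrow> y = f x"
proof -
  obtain r where "\<And>x. evaluates r [x] (f x)"
    using assms unfolding computable_def by blast
  from run_recf_code[OF this] that show thesis
    by auto
qed

section \<open>The diagonal argument\<close>

lemma ex_Pi_equiv_not_reducible:
  assumes "Pi_equiv (Suc (Suc m)) E"
  shows "\<exists>F. Pi_equiv (Suc (Suc m)) F \<and> \<not> reducible F E"
proof -
  let ?n = "Suc (Suc m)"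
  have equiv: "equiv UNIV E" and E: "Sigma_set ?n (\<lambda>p. (pfst p, psnd p) \<notin> E)"
    using assms by (auto simp: Pi_equiv_iff)
  \<comment> \<open>\<open>\<not> S (pr i (pr u v))\<close> says that \<open>i\<close> witnesses the
    inequivalence of \<open>u\<close> and \<open>v\<close>.\<close>
  obtain S where S: "Sigma_set (Suc m) S"
    and S_iff: "\<And>p. (pfst p, psnd p) \<notin> E \<longleftrightarrow> (\<exists>i. \<not> S (pr i p))"
    using E by (rule Sigma_set_SucE) blast
  have sym: "(x, y) \<in> E \<Longrightarrow> (y, x) \<in> E"
    and trans: "(x, y) \<in> E \<Longrightarrow> (y, z) \<in> E \<Longrightarrow> (x, z) \<in> E" for x y z
    using equiv by (auto elim!: equivE dest: symD transD)
  define U where "U e x y \<longleftrightarrow> run e (pr x 0) y" for e x y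

  \<comment> \<open>\<open>A p\<close> permits placing \<open>p\<close> in the class of
    \<open>b = pr (pfst p) 1\<close>; here \<open>u\<close>, \<open>v\<close>, \<open>z\<close> are
    the images of \<open>a\<close>, \<open>b\<close> and \<open>p\<close>.\<close>
  define A where "A p \<longleftrightarrow> psnd p = 1 \<or>
    (\<exists>i u v z. psnd p = Suc (Suc i) \<and> U (pfst p) (pr (pfst p) 0) u \<and> U (pfst p) (pr (pfst p) 1) v \<and>
       U (pfst p) p z \<and> \<not> S (pr i (pr u v)) \<and> (v, z) \<notin> E)" for p
  \<comment> \<open>\<open>B p\<close> permits placing \<open>p\<close> in the class of
    \<open>a = pr (pfst p) 0\<close>. It is also the default when some image is undefined or
    \<open>i\<close> is no witness, so that \<open>A\<close> and \<open>B\<close> cover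
    everything.\<close>
  define B where "B p \<longleftrightarrow> psnd p = 0 \<or>
    (\<exists>i. psnd p = Suc (Suc i) \<and>
       (\<not> (\<exists>u. U (pfst p) (pr (pfst p) 0) u) \<or> \<not> (\<exists>v. U (pfst p) (pr (pfst p) 1) v) \<or>
        \<not> (\<exists>z. U (pfst p) p z) \<or>
        (\<exists>u v z. U (pfst p) (pr (pfst p) 0) u \<and> U (pfst p) (pr (pfst p) 1) v \<and> U (pfst p) p z \<and>
          (S (pr i (pr u v)) \<or> (u, z) \<notin> E))))" for p

  have U: "Sigma_set (Suc k) (\<lambda>x. U (f x) (g x) (h x))"
    if "computable f" "computable g" "computable h" for k f g h
    using Sigma_set_comp[OF Sigma_set_run, of "\<lambda>x. pr (f x) (pr (pr (g x) 0) (h x))"] that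
    by (simp add: U_def computable_intros)
  \<comment> \<open>Divergence is \<open>\<Pi>\<^sub>1\<close>, hence
    \<open>\<Sigma>\<^sub>n\<close> because \<open>1 < n\<close>.\<close>
  have nU: "Sigma_set ?n (\<lambda>x. \<not> (\<exists>y. U (f x) (g x) y))" if "computable f" "computable g" for f g
    by (rule Sigma_set_not_mono[of 1], simp, unfold One_nat_def)
      (intro Sigma_set_ex U computable_intros computable_comp[OF that(1)] computable_comp[OF that(2)])
  have E': "Sigma_set ?n (\<lambda>x. (f x, g x) \<notin> E)" if "computable f" "computable g" for f g
    using Sigma_set_comp[OF E computable_pr[OF that]] by simp
  note S' = Sigma_set_Suc[OF S, THEN Sigma_set_comp] Sigma_set_Suc_not[OF S, THEN Sigma_set_comp]

  have "Sigma_set ?n A"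
    unfolding A_def
    by (intro Sigma_set_disj Sigma_set_ex Sigma_set_conj Sigma_set_eq U E' S' computable_intros)
  moreover have "Sigma_set ?n B"
    unfolding B_def
    by (intro Sigma_set_disj nU Sigma_set_ex Sigma_set_conj Sigma_set_eq U E' S' computable_intros)
  moreover have "A p \<or> B p" for p
  proof -
    consider "psnd p = 0" | "psnd p = 1" | i where "psnd p = Suc (Suc i)"
      by (metis One_nat_def not0_implies_Suc)
    then show ?thesis
    proof cases
      case 3
      \<comment> \<open>Were \<open>z\<close> equivalent to both \<open>u\<close> and
        \<open>v\<close>, these would be equivalent to each other, against the witness
        \<open>i\<close>.\<close>
      have "(v, z) \<notin> E \<or> (u, z) \<notin> E" if "\<not> S (pr i (pr u v))" for u v z
        using S_iff[of "pr u v"] that sym trans by (metis pfst_pr psnd_pr)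
      with 3 show ?thesis
        unfolding A_def B_def by blast
    qed (simp_all add: A_def B_def)
  qed
  ultimately obtain H where H: "Sigma_set ?n H" "Sigma_set ?n (\<lambda>x. \<not> H x)"
    and HA: "\<And>p. H p \<Longrightarrow> A p" and HB: "\<And>p. \<not> H p \<Longrightarrow> B p"
    by (rule Sigma_set_reduction) blast

  define F where "F = {(p, q). pfst p = pfst q \<and> (H p \<longleftrightarrow> H q)}"
  \<comment> \<open>This is the complement of \<open>F\<close>; it is
    \<open>\<Sigma>\<^sub>n\<close> because both \<open>H\<close> and its negation are.\<close>
  have "Sigma_set ?n (\<lambda>p. \<not> pfst (pfst p) = pfst (psnd p) \<or>
      (H (pfst p) \<and> \<not> H (psnd p)) \<or> (\<not> H (pfst p) \<and> H (psnd p)))"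
    by (intro Sigma_set_disj Sigma_set_conj H[THEN Sigma_set_comp] Sigma_set_decidable
        decidable_not decidable_eq computable_intros)
  moreover have "equiv UNIV F"
    by (auto simp: F_def intro!: equivI refl_onI symI transI)
  ultimately have "Pi_equiv ?n F"
    unfolding Pi_equiv_iff F_def by (auto elim!: back_subst[of "Sigma_set ?n"])
  moreover have "\<not> reducible F E"
  proof
    assume "reducible F E"
    then obtain f where "computable f" and f: "\<And>p q. (p, q) \<in> F \<longleftrightarrow> (f p, f q) \<in> E"
      unfolding reducible_def by blast
    then obtain e where e: "\<And>x y. U e x y \<longleftrightarrow> y = f x"
      using computable_run unfolding U_def by metis
    \<comment> \<open>At \<open>a\<close> only \<open>B\<close> holds and at \<open>b\<close> only
      \<open>A\<close>, so the value of \<open>H\<close> is forced at both.\<close>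
    have a: "\<not> H (pr e 0)"
      using HA[of "pr e 0"] by (auto simp: A_def)
    have b: "H (pr e 1)"
      using HB[of "pr e 1"] by (auto simp: B_def)
    have "(f (pr e 0), f (pr e 1)) \<notin> E"
      using a b by (simp add: F_def flip: f)
    then obtain i where i: "\<not> S (pr i (pr (f (pr e 0)) (f (pr e 1))))"
      using S_iff[of "pr (f (pr e 0)) (f (pr e 1))"] by auto
    define c where "c = pr e (Suc (Suc i))"
    show False
    proof (cases "H c")
      case True
      then have "(f (pr e 1), f c) \<notin> E"
        using HA[of c] by (auto simp: A_def c_def e)
      moreover have "(pr e 1, c) \<in> F"
        using True b by (simp add: F_def c_def)
      ultimately show False
        using f by blast
    next
      case False
      \<comment> \<open>Since \<open>f\<close> is total and \<open>i\<close> is a witness, every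
        default clause of \<open>B\<close> fails and only the separation from \<open>a\<close>
        remains.\<close>
      then have "(f (pr e 0), f c) \<notin> E"
        using HB[of c] i by (auto simp: B_def c_def e)
      moreover have "(pr e 0, c) \<in> F"
        using False a by (simp add: F_def c_def)
      ultimately show False
        using f by blast
    qed
  qed
  ultimately show ?thesis
    by blast
qed

theorem theorem5p9:
  fixes n :: nat
  assumes "n \<ge> 2"
  shows "\<not> (\<exists>E. Pi_complete n E) \<and>
    (\<forall>E. Pi_equiv n E \<longrightarrow> (\<exists>F. Pi_equiv n F \<and> \<not> reducible F E))"
proof -
  obtain m where "n = Suc (Suc m)"
    using assms by (metis add_2_eq_Suc le_Suc_ex)
  then have "\<forall>E. Pi_equiv n E \<longrightarrow> (\<exists>F. Pi_equiv n F \<and> \<not> reducible F E)"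
    using ex_Pi_equiv_not_reducible by blast
  then show ?thesis
    unfolding Pi_complete_def by blast
qed

end
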